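(* Let $P$ be a set of $n$ points in the plane in general position such that exactly one point of $P$ lies in the interior of the convex hull of $P$. Then there exists a generalized wheel $GW_N$ on $n$ points and a bijection $\varphi$ from $P$ to the point set of $GW_N$ such that for any four points $a,b,c,d\in P$, the segments $ab$ and $cd$ cross if and only if the segments $\varphi(a)\varphi(b)$ and $\varphi(c)\varphi(d)$ cross (i.e., $P$ and $GW_N$ have the same set of crossing edge pairs).
   Context: Two segments cross if they share a point of their relative interiors. Let $k\ge 3$ be odd and $N=[n_1,\dots,n_k]$ with integers $n_i\ge 1$. The generalized wheel $GW_N$ is the (complete geometric graph on the) point set consisting of a center point $v_0$ together with $k$ groups $\mathcal{G}_1,\dots,\mathcal{G}_k$ in this circular order, where group $\mathcal{G}_i$ consists of $n_i$ points that are $\varepsilon$-close (for sufficiently small $\varepsilon>0$) to the $i$-th vertex of a regular $k$-gon centered at $v_0$, all points other than $v_0$ lie on the convex hull in convex position (in general position), and $v_0$ is the only interior point; it has $1+\sum_i n_i$ points. Here no parity condition on $\sum_i n_i$ is imposed. *)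

theory Defs
  imports "HOL-Analysis.Analysis"
begin

text \<open>The plane is the type \<^typ>\<open>complex\<close>.\<close>

definition general_position :: "complex set \<Rightarrow> bool" where
  "general_position S \<longleftrightarrow>
     (\<forall>a\<in>S. \<forall>b\<in>S. \<forall>c\<in>S. a \<noteq> b \<longrightarrow> a \<noteq> c \<longrightarrow> b \<noteq> c \<longrightarrow> \<not> collinear {a, b, c})"

definition cross :: "complex \<Rightarrow> complex \<Rightarrow> complex \<Rightarrow> complex \<Rightarrow> bool" where
  "cross a b c d \<longleftrightarrow>
     rel_interior (closed_segment a b) \<inter> rel_interior (closed_segment c d) \<noteq> {}"

text \<open>
  The regular \<open>k\<close>-gon is given by its center \<open>v0\<close> and the vector \<open>u\<close> from the center to vertex
  number 0; vertices are numbered counterclockwise from 0 to \<open>k - 1\<close>. Closeness is measured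
  relative to the circumradius \<open>norm u\<close>: otherwise a polygon shrunk below \<open>\<epsilon>\<close> would make the
  closeness condition void. Smallness of \<open>\<epsilon>\<close> is not part of the definition; it is
  to be expressed by the filter \<^term>\<open>at_right (0::real)\<close> where the predicate is used.
\<close>

definition generalized_wheel :: "real \<Rightarrow> nat list \<Rightarrow> complex set \<Rightarrow> bool" where
  "generalized_wheel \<epsilon> N W \<longleftrightarrow>
     (let k = length N in
      3 \<le> k \<and> odd k \<and> (\<forall>i<k. 1 \<le> N ! i) \<and>
      (\<exists>v0 u G.
         u \<noteq> 0 \<and>
         W = insert v0 (\<Union>i<k. G i) \<and>
         disjoint_family_on G {..<k} \<and>
         (\<forall>i<k. finite (G i) \<and> card (G i) = N ! i) \<and>
         (\<forall>i<k. \<forall>p\<in>G i. dist p (v0 + u * cis (2 * pi * real i / real k)) < \<epsilon> * norm u) \<and>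
         general_position W \<and>
         (\<forall>i<k. \<forall>p\<in>G i. p extreme_point_of (convex hull W)) \<and>
         W \<inter> interior (convex hull W) = {v0}))"

end

theory Submission
  imports Defs
begin

text \<open>
  Crossings are determined by the orientations of triples. Let \<open>p\<close> be the interior point and \<open>Q\<close> the
  set of the other points. The orientations of the triples containing \<open>p\<close> determine those of the
  triples in \<open>Q\<close>: a point \<open>b\<close> between \<open>a\<close> and \<open>c\<close>, seen from \<open>p\<close>, must lie
  beyond the segment \<open>ac\<close>, as otherwise it would be interior to the triangle \<open>pac\<close>.

  Sort the lines joining \<open>p\<close> to the points of \<open>Q\<close> by slope in \<open>[0, \<pi>)\<close> and record by a sign on which half
  of its line each point lies. Two points are oriented around \<open>p\<close> according to the product of
  their signs. The maximal runs of equal signs are the groups of the wheel, since the vertices of a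
  regular \<open>k\<close>-gon with odd \<open>k\<close>, sorted in the same way, have alternating signs. If the number of runs
  is even, the first and the last run form a single group, which makes the number \<open>k\<close> of groups odd.
  At most two runs would put all points on one side of a line through \<open>p\<close>, hence \<open>k \<ge> 3\<close>.
\<close>

section \<open>Orientations and crossings\<close>

text \<open>Twice the signed area of the triangle \<open>a b c\<close>, positive for a
  counterclockwise triple.\<close>

definition orient :: "complex \<Rightarrow> complex \<Rightarrow> complex \<Rightarrow> real" where
  "orient a b c = (Re b - Re a) * (Im c - Im a) - (Im b - Im a) * (Re c - Re a)"

lemma orient_degenerate [simp]:
  "orient a a b = 0" "orient a b a = 0" "orient a b b = 0"
  by (simp_all add: orient_def)

lemma orient_rotate: "orient b c a = orient a b c"
  by (simp add: orient_def algebra_simps)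

lemma orient_swap: "orient a c b = - orient a b c"
  by (simp add: orient_def algebra_simps)

text \<open>The signed areas of the triangles with apex \<open>p\<close> over the three sides add
  up, even when \<open>p\<close> lies outside.\<close>

lemma orient_eq_sum: "orient a b c = orient p a b + orient p b c + orient p c a"
  by (simp add: orient_def algebra_simps)

lemma orient_convex_comb:
  "orient a b ((1 - u) *\<^sub>R c + u *\<^sub>R d) = (1 - u) * orient a b c + u * orient a b d"
  by (simp add: orient_def algebra_simps)

lemma collinear_iff_orient: "collinear {a, b, c} \<longleftrightarrow> orient a b c = 0"
proof (cases "a = b")
  case False
  have "collinear {a, b, c} \<longleftrightarrow> collinear {b, a, c}"
    by (simp add: insert_commute)
  also have "\<dots> \<longleftrightarrow> collinear {0, b - a, c - a}"
    by (subst collinear_3) (auto simp: NO_MATCH_def)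
  also have "\<dots> \<longleftrightarrow> Im ((c - a) / (b - a)) = 0"
    by (simp only: collinear_iff_Reals complex_is_Real_iff)
  also have "\<dots> \<longleftrightarrow> orient a b c = 0"
    using False by (auto simp: Im_divide orient_def algebra_simps complex_eq_iff
        simp flip: power2_eq_square)
  finally show ?thesis .
qed simp

lemma general_position_iff_orient:
  "general_position S \<longleftrightarrow>
    (\<forall>a\<in>S. \<forall>b\<in>S. \<forall>c\<in>S. a \<noteq> b \<longrightarrow> a \<noteq> c \<longrightarrow> b \<noteq> c \<longrightarrow> orient a b c \<noteq> 0)"
  by (simp add: general_position_def collinear_iff_orient)

lemma rel_interior_segment_iff:
  fixes a b x :: complex
  shows "x \<in> rel_interior (closed_segment a b) \<longleftrightarrow> (\<exists>u. 0 < u \<and> u < 1 \<and> x = (1 - u) *\<^sub>R a + u *\<^sub>R b)"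
proof (cases "a = b")
  case True
  then show ?thesis
    by (auto simp: rel_interior_closed_segment algebra_simps intro!: exI[of _ "1/2"])
next
  case False
  then show ?thesis by (simp add: rel_interior_closed_segment in_segment)
qed

lemma affine_zero_cases:
  fixes u x y :: real
  assumes "0 < u" "u < 1" "(1 - u) * x + u * y = 0"
  shows "x * y < 0 \<or> x = 0 \<and> y = 0"
proof (cases "y = 0")
  case False
  have "(1 - u) * (x * y) = - (u * y\<^sup>2)"
    using assms(3) by (simp add: power2_eq_square) algebra
  moreover have "u * y\<^sup>2 > 0" using assms False by simp
  ultimately have "(1 - u) * (x * y) < 0" by simp
  then show ?thesis using assms by (simp add: mult_less_0_iff)
qed (use assms in auto)

lemma opposite_signs_param:
  fixes x y :: real
  assumes "x * y < 0"
  shows "0 < x / (x - y)" "x / (x - y) < 1"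
  using assms by (auto simp: mult_less_0_iff field_simps)

text \<open>A common inner point is a zero of the affine function \<open>orient a b\<close> between
  \<open>c\<close> and \<open>d\<close>, and of \<open>orient c d\<close> between \<open>a\<close>
  and \<open>b\<close>; hence opposite signs, unless both end values vanish. Equality of the pairs
  covers identical segments, including single points, whose relative interior is the point
  itself.\<close>

lemma cross_iff_orient:
  assumes gp: "general_position S" and S: "a \<in> S" "b \<in> S" "c \<in> S" "d \<in> S"
  shows "cross a b c d \<longleftrightarrow> {a, b} = {c, d} \<or>
    orient a b c * orient a b d < 0 \<and> orient c d a * orient c d b < 0"
proof
  assume "cross a b c d"
  then obtain x where "x \<in> rel_interior (closed_segment a b)" "x \<in> rel_interior (closed_segment c d)"
    by (auto simp: cross_def)
  then obtain u v where u: "0 < u" "u < 1" "x = (1 - u) *\<^sub>R a + u *\<^sub>R b"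
    and v: "0 < v" "v < 1" "x = (1 - v) *\<^sub>R c + v *\<^sub>R d"
    unfolding rel_interior_segment_iff by blast
  have "orient a b x = 0" by (simp add: u(3) orient_convex_comb)
  then have ab: "orient a b c * orient a b d < 0 \<or> orient a b c = 0 \<and> orient a b d = 0"
    using affine_zero_cases[OF v(1,2)] by (simp add: v(3) orient_convex_comb)
  have "orient c d x = 0" by (simp add: v(3) orient_convex_comb)
  then have cd: "orient c d a * orient c d b < 0 \<or> orient c d a = 0 \<and> orient c d b = 0"
    using affine_zero_cases[OF u(1,2)] by (simp add: u(3) orient_convex_comb)
  have zero: "p = q \<or> p = r \<or> q = r" if "orient p q r = 0" "p \<in> S" "q \<in> S" "r \<in> S" for p q r
    using gp that by (auto simp: general_position_iff_orient)
  have inner: "x \<noteq> a" "x \<noteq> b" if "a \<noteq> b"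
  proof -
    have "x - a = u *\<^sub>R (b - a)" "x - b = (1 - u) *\<^sub>R (a - b)"
      by (simp_all add: u(3) algebra_simps)
    then show "x \<noteq> a" "x \<noteq> b" using u that by auto
  qed
  have inner': "x \<noteq> c" "x \<noteq> d" if "c \<noteq> d"
  proof -
    have "x - c = v *\<^sub>R (d - c)" "x - d = (1 - v) *\<^sub>R (c - d)"
      by (simp_all add: v(3) algebra_simps)
    then show "x \<noteq> c" "x \<noteq> d" using v that by auto
  qed
  have xa: "x = a" if "a = b" using u(3) that by (simp add: algebra_simps)
  have xc: "x = c" if "c = d" using v(3) that by (simp add: algebra_simps)
  \<comment> \<open>General position leaves only coincidences among the four points, and the
    relative interior of a nondegenerate segment omits its endpoints.\<close>
  have "{a, b} = {c, d}" if z: "orient a b c = 0" "orient a b d = 0"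
  proof (cases "a = b")
    case True
    then have "orient c d a = 0" using cd by (auto simp: mult_less_0_iff)
    then have "c = d \<or> a = c \<or> a = d" using zero S by blast
    then show ?thesis using True inner' xa xc by (metis insert_absorb2)
  next
    case False
    then have "c = a \<or> c = b" "d = a \<or> d = b" using zero S z by metis+
    moreover have "c \<noteq> d"
      using inner[OF False] calculation xc by auto
    ultimately show ?thesis by auto
  qed
  moreover have "{a, b} = {c, d}" if z: "orient c d a = 0" "orient c d b = 0"
  proof (cases "c = d")
    case True
    then have "orient a b c = 0" using ab by (auto simp: mult_less_0_iff)
    then have "a = b \<or> a = c \<or> b = c" using zero S by blast
    then show ?thesis using True inner xa xc by (metis insert_absorb2)
  next
    case False
    then have "a = c \<or> a = d" "b = c \<or> b = d" using zero S z by metis+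
    moreover have "a \<noteq> b"
      using inner'[OF False] calculation xa by auto
    ultimately show ?thesis by auto
  qed
  ultimately show "{a, b} = {c, d} \<or>
    orient a b c * orient a b d < 0 \<and> orient c d a * orient c d b < 0"
    using ab cd by blast
next
  assume "{a, b} = {c, d} \<or>
    orient a b c * orient a b d < 0 \<and> orient c d a * orient c d b < 0"
  then show "cross a b c d"
  proof
    assume "{a, b} = {c, d}"
    then have eq: "closed_segment c d = closed_segment a b"
      by (metis closed_segment_commute doubleton_eq_iff)
    show ?thesis by (simp add: cross_def eq rel_interior_eq_empty)
  next
    assume *: "orient a b c * orient a b d < 0 \<and> orient c d a * orient c d b < 0"
    \<comment> \<open>The parameters at which \<open>orient c d\<close> vanishes along
      \<open>ab\<close> and \<open>orient a b\<close> along \<open>cd\<close>. Their denominators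
      are opposite (\<open>DD\<close>), so multiplying by one of them turns the equality of the two
      points into a polynomial identity.\<close>
    define u where "u = orient c d a / (orient c d a - orient c d b)"
    define v where "v = orient a b c / (orient a b c - orient a b d)"
    have D: "orient c d a - orient c d b \<noteq> 0" using * by (auto simp: mult_less_0_iff)
    have uv: "0 < u" "u < 1" "0 < v" "v < 1"
      unfolding u_def v_def using opposite_signs_param * by blast+
    have DD: "orient a b c - orient a b d = - (orient c d a - orient c d b)"
      by (simp add: orient_def algebra_simps)
    have "(orient c d a - orient c d b) *\<^sub>R ((1 - u) *\<^sub>R a + u *\<^sub>R b) =
        (orient c d a - orient c d b) *\<^sub>R ((1 - v) *\<^sub>R c + v *\<^sub>R d)"
    proof -
      have "(orient c d a - orient c d b) * u = orient c d a" using D by (simp add: u_def)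
      moreover have "(orient c d a - orient c d b) * v = - orient a b c"
        using D unfolding v_def DD by (simp add: field_simps)
      moreover have "- orient c d b *\<^sub>R a + orient c d a *\<^sub>R b
          = (orient c d a - orient c d b + orient a b c) *\<^sub>R c - orient a b c *\<^sub>R d"
        by (simp add: complex_eq_iff orient_def algebra_simps)
      ultimately show ?thesis
        by (simp add: scaleR_add_right right_diff_distrib)
    qed
    then have "(1 - u) *\<^sub>R a + u *\<^sub>R b = (1 - v) *\<^sub>R c + v *\<^sub>R d"
      using D by simp
    then have "(1 - u) *\<^sub>R a + u *\<^sub>R b \<in> rel_interior (closed_segment a b) \<inter> rel_interior (closed_segment c d)"
      unfolding rel_interior_segment_iff Int_iff using uv by blast
    then show ?thesis unfolding cross_def by blast
  qed
qed

lemma cross_cong_orient: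
  assumes S: "general_position S" and T: "general_position T" and bij: "bij_betw \<phi> S T"
    and sgn: "\<And>a b c. a \<in> S \<Longrightarrow> b \<in> S \<Longrightarrow> c \<in> S \<Longrightarrow>
      sgn (orient (\<phi> a) (\<phi> b) (\<phi> c)) = sgn (orient a b c)"
    and abcd: "a \<in> S" "b \<in> S" "c \<in> S" "d \<in> S"
  shows "cross a b c d \<longleftrightarrow> cross (\<phi> a) (\<phi> b) (\<phi> c) (\<phi> d)"
proof -
  have "{\<phi> a, \<phi> b} = {\<phi> c, \<phi> d} \<longleftrightarrow> {a, b} = {c, d}"
    using inj_on_image_eq_iff[OF bij_betw_imp_inj_on[OF bij], of "{a, b}" "{c, d}"] abcd by simp
  moreover have "orient (\<phi> p) (\<phi> q) (\<phi> r) * orient (\<phi> p) (\<phi> q) (\<phi> s) < 0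
      \<longleftrightarrow> orient p q r * orient p q s < 0" if "p \<in> S" "q \<in> S" "r \<in> S" "s \<in> S" for p q r s
    using sgn[of p q r] sgn[of p q s] that by (metis sgn_less sgn_mult)
  ultimately show ?thesis
    using abcd bij_betwE[OF bij] by (simp add: cross_iff_orient[OF S] cross_iff_orient[OF T])
qed

lemma general_position_cong_orient:
  assumes "general_position S" "bij_betw \<phi> S T"
    and sgn: "\<And>a b c. a \<in> S \<Longrightarrow> b \<in> S \<Longrightarrow> c \<in> S \<Longrightarrow>
      sgn (orient (\<phi> a) (\<phi> b) (\<phi> c)) = sgn (orient a b c)"
  shows "general_position T"
  unfolding general_position_iff_orient
proof (intro ballI impI)
  fix x y z assume xyz: "x \<in> T" "y \<in> T" "z \<in> T" and ne: "x \<noteq> y" "x \<noteq> z" "y \<noteq> z"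
  have "T = \<phi> ` S" using assms(2) by (simp add: bij_betw_def)
  then obtain a b c where abc: "a \<in> S" "b \<in> S" "c \<in> S" "x = \<phi> a" "y = \<phi> b" "z = \<phi> c"
    using xyz by (metis imageE)
  then have "orient a b c \<noteq> 0"
    using assms(1) ne unfolding general_position_iff_orient by metis
  then show "orient x y z \<noteq> 0"
    using sgn[of a b c] abc by (metis sgn_zero_iff)
qed

section \<open>Orientations around a point\<close>

text \<open>Of the three cyclic orientations around \<open>p\<close> of a triple, two have the same sign. The second
  condition, applied to the triple or its reversal, makes the orientation of the triple equal to this
  majority sign, so that the orientations around \<open>p\<close> determine all others.\<close>

definition star_position :: "complex \<Rightarrow> complex set \<Rightarrow> bool" where
  "star_position p Q \<longleftrightarrow>
    (\<forall>a\<in>Q. \<forall>b\<in>Q. a \<noteq> b \<longrightarrow> orient p a b \<noteq> 0) \<and>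
    (\<forall>a\<in>Q. \<forall>b\<in>Q. \<forall>c\<in>Q. 0 < orient p a b \<longrightarrow> 0 < orient p b c \<longrightarrow> 0 < orient a b c)"

lemma star_position_orient_cong:
  assumes Q: "star_position p Q" and R: "star_position p' (\<phi> ` Q)"
    and sgn: "\<And>a b. a \<in> Q \<Longrightarrow> b \<in> Q \<Longrightarrow> sgn (orient p' (\<phi> a) (\<phi> b)) = sgn (orient p a b)"
    and abc: "a \<in> Q" "b \<in> Q" "c \<in> Q"
  shows "sgn (orient (\<phi> a) (\<phi> b) (\<phi> c)) = sgn (orient a b c)"
proof -
  have pos: "sgn (orient (\<phi> x) (\<phi> y) (\<phi> z)) = 1 \<and> sgn (orient x y z) = 1"
    if "0 < orient p x y" "0 < orient p y z" "x \<in> Q" "y \<in> Q" "z \<in> Q" for x y z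
  proof -
    have "0 < orient p' (\<phi> x) (\<phi> y)" "0 < orient p' (\<phi> y) (\<phi> z)"
      using sgn[of x y] sgn[of y z] that by (auto simp: sgn_1_pos)
    then show ?thesis using Q R that by (auto simp: star_position_def)
  qed
  consider "a = b \<or> b = c \<or> a = c" | "a \<noteq> b" "b \<noteq> c" "a \<noteq> c" by blast
  then show ?thesis
  proof cases
    case 2
    then have nz: "orient p a b \<noteq> 0" "orient p b c \<noteq> 0" "orient p c a \<noteq> 0"
      using Q abc by (auto simp: star_position_def)
    \<comment> \<open>Two of three nonzero reals share a sign. Rotating the triple, and reversing it
      when that sign is negative, reduces each case to \<open>pos\<close>.\<close>
    then consider "0 < orient p a b" "0 < orient p b c" | "0 < orient p b c" "0 < orient p c a"
      | "0 < orient p c a" "0 < orient p a b" | "orient p a b < 0" "orient p b c < 0"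
      | "orient p b c < 0" "orient p c a < 0" | "orient p c a < 0" "orient p a b < 0"
      by linarith
    then show ?thesis
    proof cases
      case 1
      then show ?thesis using pos[of a b c] abc by simp
    next
      case 2
      then show ?thesis using pos[of b c a] abc by (metis orient_rotate)
    next
      case 3
      then show ?thesis using pos[of c a b] abc by (metis orient_rotate)
    next
      case 4
      then have "sgn (orient (\<phi> c) (\<phi> b) (\<phi> a)) = sgn (orient c b a)"
        using pos[of c b a] abc orient_swap[of p b c] orient_swap[of p a b] by simp
      then show ?thesis
        by (metis orient_rotate orient_swap sgn_minus neg_equal_iff_equal)
    next
      case 5
      then have "sgn (orient (\<phi> a) (\<phi> c) (\<phi> b)) = sgn (orient a c b)"
        using pos[of a c b] abc orient_swap[of p c a] orient_swap[of p b c] by simp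
      then show ?thesis by (metis orient_swap sgn_minus neg_equal_iff_equal)
    next
      case 6
      then have "sgn (orient (\<phi> b) (\<phi> a) (\<phi> c)) = sgn (orient b a c)"
        using pos[of b a c] abc orient_swap[of p a b] orient_swap[of p c a] by simp
      then show ?thesis
        by (metis orient_rotate orient_swap sgn_minus neg_equal_iff_equal)
    qed
  qed auto
qed

lemma star_position_insert_orient_cong:
  assumes Q: "star_position p Q" and R: "star_position (\<phi> p) (\<phi> ` Q)"
    and sgn: "\<And>a b. a \<in> Q \<Longrightarrow> b \<in> Q \<Longrightarrow> sgn (orient (\<phi> p) (\<phi> a) (\<phi> b)) = sgn (orient p a b)"
    and abc: "a \<in> insert p Q" "b \<in> insert p Q" "c \<in> insert p Q"
  shows "sgn (orient (\<phi> a) (\<phi> b) (\<phi> c)) = sgn (orient a b c)"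
proof (cases "a = p \<or> b = p \<or> c = p")
  case True
  then consider "a = p" | "b = p" | "c = p" by blast
  then show ?thesis
  proof cases
    case 1
    then show ?thesis using abc sgn by auto
  next
    case 2
    then have "sgn (orient (\<phi> b) (\<phi> c) (\<phi> a)) = sgn (orient b c a)" using abc sgn by auto
    then show ?thesis by (metis orient_rotate)
  next
    case 3
    then have "sgn (orient (\<phi> c) (\<phi> a) (\<phi> b)) = sgn (orient c a b)" using abc sgn by auto
    then show ?thesis by (metis orient_rotate)
  qed
next
  case False
  then show ?thesis using abc star_position_orient_cong[OF Q R sgn] by blast
qed

section \<open>Convex hulls and star position\<close>

text \<open>The barycentric coordinates of \<open>x\<close> are ratios of areas, here all
  positive.\<close>

lemma interior_triangle:
  assumes "0 < orient x a b" "0 < orient x b c" "0 < orient x c a"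
  shows "x \<in> interior (convex hull {a, b, c})"
proof -
  let ?D = "orient a b c"
  have D: "?D > 0" using assms by (simp add: orient_eq_sum[of a b c x])
  have "?D *\<^sub>R x = orient x b c *\<^sub>R a + orient x c a *\<^sub>R b + orient x a b *\<^sub>R c"
    by (simp add: complex_eq_iff orient_def algebra_simps)
  then have "x = (1 / ?D) *\<^sub>R (orient x b c *\<^sub>R a + orient x c a *\<^sub>R b + orient x a b *\<^sub>R c)"
    using D by (metis less_irrefl scaleR_one scaleR_scaleR nonzero_eq_divide_eq)
  also have "\<dots> = (orient x b c / ?D) *\<^sub>R a + (orient x c a / ?D) *\<^sub>R b + (orient x a b / ?D) *\<^sub>R c"
    by (simp add: scaleR_add_right)
  finally have x: "(orient x b c / ?D) *\<^sub>R a + (orient x c a / ?D) *\<^sub>R b + (orient x a b / ?D) *\<^sub>R c = x"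
    by simp
  have "orient x b c / ?D + orient x c a / ?D + orient x a b / ?D = 1"
    using D by (simp add: orient_eq_sum[of a b c x] flip: add_divide_distrib)
  moreover have nc: "\<not> collinear {a, b, c}" using D by (simp add: collinear_iff_orient)
  ultimately show ?thesis
    unfolding interior_convex_hull_3_minimal[OF nc DIM_complex] mem_Collect_eq
    using x assms D
    by (intro exI[of _ "orient x b c / ?D"] exI[of _ "orient x c a / ?D"]
        exI[of _ "orient x a b / ?D"]) simp
qed

lemma star_position_of_not_interior:
  assumes gp: "general_position (insert p Q)" and "p \<notin> Q"
    and hull: "\<And>b. b \<in> Q \<Longrightarrow> b \<notin> interior (convex hull (insert p Q))"
  shows "star_position p Q"
  unfolding star_position_def
proof (intro conjI ballI impI)
  fix a b assume "a \<in> Q" "b \<in> Q" "a \<noteq> b"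
  then show "orient p a b \<noteq> 0" using gp \<open>p \<notin> Q\<close> by (auto simp: general_position_iff_orient)
next
  fix a b c assume abc: "a \<in> Q" "b \<in> Q" "c \<in> Q" and pos: "0 < orient p a b" "0 < orient p b c"
  show "0 < orient a b c"
  proof (rule ccontr)
    assume "\<not> 0 < orient a b c"
    moreover have "a \<noteq> b" "b \<noteq> c" using pos by auto
    moreover have "a \<noteq> c" using pos orient_swap[of p a b] by auto
    ultimately have "orient a b c < 0"
      using gp abc by (auto simp: general_position_iff_orient not_less le_less)
    \<comment> \<open>Seen from \<open>b\<close>, the triangle \<open>p a c\<close> is
      counterclockwise on all three sides.\<close>
    then have "b \<in> interior (convex hull {p, a, c})"
      using pos orient_rotate[of p a b] orient_rotate[of b c p] orient_swap[of b a c]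
        orient_rotate[of b c a] orient_rotate[of a b c] orient_rotate[of p b c] orient_rotate[of b p a]
      by (intro interior_triangle) auto
    moreover have "interior (convex hull {p, a, c}) \<subseteq> interior (convex hull (insert p Q))"
      using abc by (intro interior_mono hull_mono) auto
    ultimately show False using hull abc by blast
  qed
qed

text \<open>For unit vectors, \<open>orient 0 x y\<close> and \<open>x \<bullet> y\<close> are the
  sine and cosine of the angle from \<open>x\<close> to \<open>y\<close>. The addition formula for
  the sine writes \<open>orient a b c\<close> as a sum of positive sines, each times one minus a
  cosine.\<close>

lemma star_position_unit_circle:
  assumes unit: "\<And>z. z \<in> Q \<Longrightarrow> cmod z = 1"
    and nz: "\<And>a b. a \<in> Q \<Longrightarrow> b \<in> Q \<Longrightarrow> a \<noteq> b \<Longrightarrow> orient 0 a b \<noteq> 0"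
  shows "star_position 0 Q"
  unfolding star_position_def
proof (intro conjI ballI impI nz)
  fix a b c assume abc: "a \<in> Q" "b \<in> Q" "c \<in> Q" and pos: "0 < orient 0 a b" "0 < orient 0 b c"
  have sq: "(orient 0 x y)\<^sup>2 + (x \<bullet> y)\<^sup>2 = 1" if "x \<in> Q" "y \<in> Q" for x y
  proof -
    have "(orient 0 x y)\<^sup>2 + (x \<bullet> y)\<^sup>2 = ((Re x)\<^sup>2 + (Im x)\<^sup>2) * ((Re y)\<^sup>2 + (Im y)\<^sup>2)"
      by (simp add: orient_def inner_complex_def power2_eq_square algebra_simps)
    then show ?thesis using unit that by (simp flip: cmod_power2)
  qed
  have lt: "x \<bullet> y < 1" if "x \<in> Q" "y \<in> Q" "0 < orient 0 x y" for x y
  proof -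
    have "(x \<bullet> y)\<^sup>2 < 1\<^sup>2" using sq[OF that(1,2)] that(3) by (smt (verit) one_power2 zero_less_power)
    then show ?thesis using power2_less_imp_less by fastforce
  qed
  have b: "Re b * Re b + Im b * Im b = 1"
    using unit[OF abc(2)] cmod_power2[of b] by (simp add: power2_eq_square)
  have "orient 0 a c = orient 0 a b * (b \<bullet> c) + (a \<bullet> b) * orient 0 b c"
  proof -
    have "orient 0 a b * (b \<bullet> c) + (a \<bullet> b) * orient 0 b c = (Re b * Re b + Im b * Im b) * orient 0 a c"
      by (simp add: orient_def inner_complex_def algebra_simps)
    then show ?thesis using b by simp
  qed
  then have "orient a b c = orient 0 a b * (1 - b \<bullet> c) + orient 0 b c * (1 - a \<bullet> b)"
    using orient_eq_sum[of a b c 0] orient_swap[of 0 a c] by (simp add: algebra_simps)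
  then show "0 < orient a b c" using lt abc pos by (simp add: add_pos_pos)
qed

lemma not_interior_hull_if_all_left:
  assumes "a \<noteq> p" and left: "\<And>z. z \<in> P \<Longrightarrow> 0 \<le> orient p a z"
  shows "p \<notin> interior (convex hull P)"
proof -
  \<comment> \<open>A quarter turn of \<open>a - p\<close>: the inner normal of the half-plane to
    the left of the line from \<open>p\<close> through \<open>a\<close>, with \<open>p\<close> on
    its boundary.\<close>
  define v where "v = \<i> * (a - p)"
  have v: "orient p a z = v \<bullet> z - v \<bullet> p" for z
    by (simp add: v_def orient_def inner_complex_def algebra_simps)
  have "v \<noteq> 0" using assms(1) by (simp add: v_def)
  have "convex hull P \<subseteq> {z. v \<bullet> z \<ge> v \<bullet> p}"
    by (rule hull_minimal) (use left v in \<open>auto simp: convex_halfspace_ge\<close>)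
  then have "interior (convex hull P) \<subseteq> {z. v \<bullet> z > v \<bullet> p}"
    using interior_mono \<open>v \<noteq> 0\<close> by (metis interior_halfspace_ge)
  then show ?thesis by auto
qed

text \<open>The radii may be negative: a signed radius selects a half of the line with slope angle
  \<alpha> or \<beta>.\<close>

lemma orient_rcis:
  assumes "a - p = rcis r \<alpha>" "b - p = rcis s \<beta>"
  shows "orient p a b = r * s * sin (\<beta> - \<alpha>)"
proof -
  have "Re a - Re p = r * cos \<alpha>" "Im a - Im p = r * sin \<alpha>"
    "Re b - Re p = s * cos \<beta>" "Im b - Im p = s * sin \<beta>"
    using assms by (simp_all add: complex_eq_iff rcis_def)
  then show ?thesis by (simp add: orient_def sin_diff algebra_simps)
qed

lemma rcis_half_turn:
  assumes "z \<noteq> 0"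
  obtains s r \<beta> where "s = 1 \<or> s = (-1::real)" "0 < r" "0 \<le> \<beta>" "\<beta> < pi" "z = rcis (s * r) \<beta>"
proof -
  \<comment> \<open>The sign moves \<open>z\<close> into the upper half-plane, with the positive
    real axis included and the negative one excluded, so that \<open>Arg\<close> falls into
    \<open>[0, \<pi>)\<close>.\<close>
  define s :: real where "s = (if 0 < Im z \<or> Im z = 0 \<and> 0 < Re z then 1 else -1)"
  have s: "s = 1 \<or> s = -1" by (simp add: s_def)
  define y where "y = of_real s * z"
  have y: "0 < Im y \<or> Im y = 0 \<and> 0 < Re y"
    using assms by (auto simp: y_def s_def complex_eq_iff)
  then have "0 \<le> Arg y" "Arg y < pi"
    using Arg_lt_pi[of y] Arg_eq_0_iff[of y] pi_gt_zero by (auto simp: complex_is_Real_iff)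
  moreover have "z = rcis (s * cmod y) (Arg y)"
  proof -
    have "z = of_real s * y" using s by (auto simp: y_def)
    also have "\<dots> = of_real s * rcis (cmod y) (Arg y)" by (simp add: rcis_cmod_Arg)
    finally show ?thesis by (simp add: rcis_def)
  qed
  moreover have "0 < cmod y" using y by auto
  ultimately show thesis using that s by blast
qed

section \<open>Sorting by slope\<close>

text \<open>Two slopes in increasing order differ by an angle in \<open>(0, \<pi>)\<close>, whose
  sine is positive, so only the signs of the radii decide the orientation.\<close>

lemma enumerate_by_direction:
  assumes "finite Q" "p \<notin> Q"
    and nz: "\<And>a b. a \<in> Q \<Longrightarrow> b \<in> Q \<Longrightarrow> a \<noteq> b \<Longrightarrow> orient p a b \<noteq> 0"
  obtains e and \<sigma> :: "nat \<Rightarrow> real" where "bij_betw e {..<card Q} Q" "range \<sigma> \<subseteq> {1, -1}"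
    "\<And>i j. i < j \<Longrightarrow> j < card Q \<Longrightarrow> sgn (orient p (e i) (e j)) = \<sigma> i * \<sigma> j"
proof -
  have "\<forall>q\<in>Q. \<exists>s r \<beta>. (s = 1 \<or> s = -1) \<and> 0 < r \<and> 0 \<le> \<beta> \<and> \<beta> < pi \<and> q - p = rcis (s * r) \<beta>"
    using rcis_half_turn \<open>p \<notin> Q\<close> by (metis right_minus_eq)
  from this[unfolded bchoice_iff] obtain s r \<beta> where
    polar': "\<forall>q\<in>Q. (s q = 1 \<or> s q = -1) \<and> 0 < r q \<and> 0 \<le> \<beta> q \<and> \<beta> q < pi
      \<and> q - p = rcis (s q * r q) (\<beta> q)"
    by blast
  note polar = bspec[OF polar']
  have orient: "orient p a b = (s a * s b) * (r a * r b * sin (\<beta> b - \<beta> a))" if "a \<in> Q" "b \<in> Q" for a b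
    using orient_rcis[of a p "s a * r a" "\<beta> a" b "s b * r b" "\<beta> b"] polar that
    by (simp add: mult_ac)
  have sgn_orient: "sgn (orient p a b) = s a * s b" if "a \<in> Q" "b \<in> Q" "\<beta> a < \<beta> b" for a b
  proof -
    have "0 < sin (\<beta> b - \<beta> a)" using polar[OF that(1)] polar[OF that(2)] that(3) by (intro sin_gt_zero) auto
    then have "0 < r a * r b * sin (\<beta> b - \<beta> a)" using polar that by simp
    moreover have "sgn (s a * s b) = s a * s b" using polar[OF that(1)] polar[OF that(2)] by auto
    ultimately show ?thesis
      by (simp only: orient[OF that(1,2)] sgn_mult[of "s a * s b"] sgn_pos mult_1_right)
  qed
  \<comment> \<open>Two points with equal slope would be collinear with \<open>p\<close>.\<close>
  have inj: "inj_on \<beta> Q"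
    by (rule inj_onI) (use nz orient in \<open>force\<close>)
  define xs where "xs = sorted_list_of_set (\<beta> ` Q)"
  have len: "length xs = card Q" by (simp add: xs_def card_image[OF inj])
  have "set xs = \<beta> ` Q" using \<open>finite Q\<close> by (simp add: xs_def)
  have "bij_betw (inv_into Q \<beta> \<circ> (!) xs) {..<card Q} Q"
  proof (rule bij_betw_trans)
    show "bij_betw ((!) xs) {..<card Q} (\<beta> ` Q)"
      using \<open>finite Q\<close> len by (intro bij_betw_nth) (auto simp: xs_def)
    show "bij_betw (inv_into Q \<beta>) (\<beta> ` Q) Q"
      using inj by (simp add: bij_betw_inv_into inj_on_imp_bij_betw)
  qed
  then have bij: "bij_betw (\<lambda>i. inv_into Q \<beta> (xs ! i)) {..<card Q} Q" by (simp add: comp_def)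
  have \<beta>: "\<beta> (inv_into Q \<beta> (xs ! i)) = xs ! i" if "i < card Q" for i
    using that len \<open>set xs = \<beta> ` Q\<close> by (intro f_inv_into_f) (metis nth_mem)
  \<comment> \<open>The default 1 keeps every value of \<sigma> a sign.\<close>
  define \<sigma> where "\<sigma> i = (if i < card Q then s (inv_into Q \<beta> (xs ! i)) else 1)" for i
  show thesis
  proof (rule that[OF bij, of \<sigma>])
    show "range \<sigma> \<subseteq> {1, -1}"
      using polar bij_betwE[OF bij] by (auto simp: \<sigma>_def)
    show "sgn (orient p (inv_into Q \<beta> (xs ! i)) (inv_into Q \<beta> (xs ! j))) = \<sigma> i * \<sigma> j"
      if "i < j" "j < card Q" for i j
    proof -
      have "xs ! i < xs ! j"
        using that len by (intro sorted_wrt_nth_less[of "(<)"]) (auto simp: xs_def)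
      then show ?thesis
        using that bij_betwE[OF bij] \<beta> by (subst sgn_orient) (auto simp: \<sigma>_def)
    qed
  qed
qed

section \<open>Runs of equal signs\<close>

text \<open>The number of sign changes up to position \<open>i\<close>, which is the index, counted
  from 0, of the run containing \<open>i\<close>.\<close>

definition flips :: "(nat \<Rightarrow> real) \<Rightarrow> nat \<Rightarrow> nat" where
  "flips \<sigma> i = (\<Sum>j<i. if \<sigma> j = \<sigma> (Suc j) then 0 else 1)"

lemma flips_0 [simp]: "flips \<sigma> 0 = 0"
  and flips_Suc: "flips \<sigma> (Suc i) = flips \<sigma> i + (if \<sigma> i = \<sigma> (Suc i) then 0 else 1)"
  by (simp_all add: flips_def)

lemma mono_flips: "mono (flips \<sigma>)"
  by (simp add: mono_iff_le_Suc flips_Suc)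

lemma sign_eq_flips:
  assumes "range \<sigma> \<subseteq> {1, -1}"
  shows "\<sigma> i = \<sigma> 0 * (-1) ^ flips \<sigma> i"
proof (induction i)
  case (Suc i)
  have "\<sigma> (Suc i) = - \<sigma> i" if "\<sigma> i \<noteq> \<sigma> (Suc i)"
    using that assms[THEN subsetD, OF rangeI, of i] assms[THEN subsetD, OF rangeI, of "Suc i"] by auto
  then show ?case using Suc by (cases "\<sigma> i = \<sigma> (Suc i)") (simp_all add: flips_Suc)
qed simp

lemma sign_mult_eq_flips:
  assumes "range \<sigma> \<subseteq> {1, -1}"
  shows "\<sigma> i * \<sigma> j = (-1) ^ (flips \<sigma> i + flips \<sigma> j)"
proof -
  have "\<sigma> 0 * \<sigma> 0 = 1" using assms[THEN subsetD, OF rangeI, of 0] by auto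
  then show ?thesis
    by (subst (1 2) sign_eq_flips[OF assms]) (simp add: power_add mult_ac)
qed

text \<open>A discrete intermediate value property: \<open>flips\<close> starts at 0 and grows by at
  most 1 per step.\<close>

lemma flips_onto: "n \<le> flips \<sigma> i \<Longrightarrow> \<exists>j\<le>i. flips \<sigma> j = n"
proof (induction i)
  case (Suc i)
  then show ?case
    by (cases "n \<le> flips \<sigma> i") (auto simp: flips_Suc le_Suc_eq split: if_splits)
qed simp

text \<open>For points sorted by slope, these signs put all others to the left of the line from the
  center through point \<open>t\<close>. It suffices to take for \<open>t\<close> the start of the
  last of at most two runs.\<close>

lemma few_flips_source:
  assumes "range \<sigma> \<subseteq> {1, -1}" and "0 < m" and few: "flips \<sigma> (m - 1) \<le> 1"
  obtains t where "t < m" "\<And>j. t < j \<Longrightarrow> j < m \<Longrightarrow> \<sigma> t * \<sigma> j = 1" "\<And>j. j < t \<Longrightarrow> \<sigma> j * \<sigma> t = -1"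
proof -
  define t where "t = (LEAST i. flips \<sigma> i = flips \<sigma> (m - 1))"
  have t: "flips \<sigma> t = flips \<sigma> (m - 1)" "t \<le> m - 1"
    unfolding t_def by (rule LeastI, rule refl) (rule Least_le, rule refl)
  show thesis
  proof
    show "t < m" using t \<open>0 < m\<close> by linarith
    show "\<sigma> t * \<sigma> j = 1" if "t < j" "j < m" for j
    proof -
      have "flips \<sigma> t \<le> flips \<sigma> j" "flips \<sigma> j \<le> flips \<sigma> (m - 1)"
        using that by (auto intro: monoD[OF mono_flips])
      then have "flips \<sigma> j = flips \<sigma> t" using t by simp
      then show ?thesis using sign_mult_eq_flips[OF assms(1), of t j] by (simp add: power_add)

    qed
    show "\<sigma> j * \<sigma> t = -1" if "j < t" for j
    proof -
      have "flips \<sigma> j \<noteq> flips \<sigma> t" using not_less_Least[of j] that t unfolding t_def by metis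
      moreover have "flips \<sigma> j \<le> flips \<sigma> t" using that by (auto intro: monoD[OF mono_flips])
      ultimately have "flips \<sigma> j = 0" "flips \<sigma> t = 1" using t few by linarith+
      then show ?thesis using sign_mult_eq_flips[OF assms(1), of j t] by simp

    qed
  qed
qed

section \<open>Points near a regular polygon\<close>

text \<open>For odd \<open>k\<close> the lines through the center and the vertices of a regular \<open>k\<close>-gon have slopes \<open>\<pi> l / k\<close>;
  \<open>half_turn_vertex k l\<close> is the vertex on the \<open>l\<close>-th line, which lies in direction \<open>(-1)\<^sup>l cis (\<pi> l / k)\<close>.\<close>

definition half_turn_vertex :: "nat \<Rightarrow> nat \<Rightarrow> nat" where
  "half_turn_vertex k l = (if even l then l div 2 else (l + k) div 2) mod k"

text \<open>Reduction mod \<open>k\<close> changes the angle by full turns. For odd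
  \<open>l\<close>, the summand \<open>k\<close> under the halving adds half a turn, which is the
  sign.\<close>

lemma cis_half_turn_vertex:
  assumes "odd k"
  shows "cis (2 * pi * real (half_turn_vertex k l) / real k) = (-1) ^ l * cis (pi * (real l / real k))"
proof -
  have k: "0 < k" using assms odd_pos by blast
  have mod: "cis (2 * pi * real (x mod k) / real k) = cis (2 * pi * real x / real k)" for x
  proof -
    have "real x = real (x div k) * real k + real (x mod k)"
      by (metis div_mult_mod_eq of_nat_add of_nat_mult)
    then have "2 * pi * real x / real k = 2 * pi * real (x div k) + 2 * pi * real (x mod k) / real k"
      using k by (simp add: field_simps)
    then show ?thesis by (simp flip: cis_mult)
  qed
  show ?thesis
  proof (cases "even l")
    case True
    then show ?thesis by (simp add: half_turn_vertex_def mod real_of_nat_div)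
  next
    case False
    then have "even (l + k)" using assms by simp
    then have "2 * pi * real ((l + k) div 2) / real k = pi * (real l / real k) + pi"
      using k by (simp add: real_of_nat_div field_simps)
    then show ?thesis using False by (simp add: half_turn_vertex_def mod flip: minus_cis)
  qed
qed

lemma half_turn_vertex_less: "0 < k \<Longrightarrow> half_turn_vertex k l < k"
  by (simp add: half_turn_vertex_def)

lemma half_turn_vertex_onto:
  assumes "odd k" "j < k"
  shows "\<exists>l<k. half_turn_vertex k l = j"
proof (cases "2 * j < k")
  case True
  then show ?thesis using assms by (intro exI[of _ "2 * j"]) (auto simp: half_turn_vertex_def)
next
  case False
  moreover have "2 * j - k + k = 2 * j" using False by simp
  moreover have "odd (2 * j - k)" using False assms by simp
  ultimately show ?thesis using assms
    by (intro exI[of _ "2 * j - k"]) (auto simp: half_turn_vertex_def)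
qed

lemma dist_cis_le: "dist (cis a) (cis b) \<le> \<bar>a - b\<bar>"
proof -
  have "cis a - cis b = cis b * (cis (a - b) - 1)"
    by (simp add: right_diff_distrib cis_mult)
  then have "cis a - cis b = cis b * (exp (\<i> * of_real (a - b)) - 1)"
    by (simp only: cis_conv_exp)
  then have "dist (cis a) (cis b) = 2 * \<bar>sin ((a - b) / 2)\<bar>"
    by (simp only: dist_norm norm_mult norm_cis dist_exp_i_1 mult_1_left)
  also have "\<dots> \<le> \<bar>a - b\<bar>" using abs_sin_x_le_abs_x[of "(a - b) / 2"] by simp
  finally show ?thesis .
qed

lemma exists_wheel_points:
  assumes \<sigma>: "range \<sigma> \<subseteq> {1, -1}" and "odd k" and flips: "flips \<sigma> (m - 1) \<le> k"
    and \<delta>: "0 < \<delta>" "\<delta> < 1"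
  obtains w where "\<And>i. cmod (w i) = 1"
    "\<And>i j. i < j \<Longrightarrow> j < m \<Longrightarrow> sgn (orient 0 (w i) (w j)) = \<sigma> i * \<sigma> j"
    "\<And>i. i < m \<Longrightarrow>
      dist (w i) (cis (2 * pi * real (half_turn_vertex k (flips \<sigma> i)) / real k)) \<le> pi * \<delta>"
proof -
  \<comment> \<open>The term \<open>i / m\<close> orders the points inside a run; as a convex combination \<open>t\<close> stays below 1 even
    if \<open>flips \<sigma> i = k\<close>, when the last run shares its vertex with the first.\<close>
  define t where "t i = (1 - \<delta>) * (real (flips \<sigma> i) / real k) + \<delta> * (real i / real m)" for i
  define w where "w i = rcis ((-1) ^ flips \<sigma> i) (pi * t i)" for i
  have k: "0 < k" using \<open>odd k\<close> odd_pos by blast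
  have le1: "real (flips \<sigma> i) / real k \<le> 1" if "i < m" for i
  proof -
    have "flips \<sigma> i \<le> flips \<sigma> (m - 1)" using that by (intro monoD[OF mono_flips]) simp
    then show ?thesis using flips k by simp
  qed
  have t: "t i < t j" "t j - t i < 1" if "i < j" "j < m" for i j
  proof -
    have "real (flips \<sigma> i) / real k \<le> real (flips \<sigma> j) / real k"
      using that monoD[OF mono_flips, of i j \<sigma>] by (intro divide_right_mono) auto
    moreover have "real i / real m < real j / real m" using that by (intro divide_strict_right_mono) auto
    ultimately show "t i < t j" unfolding t_def using \<delta>
      by (intro add_le_less_mono mult_left_mono mult_strict_left_mono) auto
    have "t j < (1 - \<delta>) * 1 + \<delta> * 1" unfolding t_def using \<delta> le1 that
      by (intro add_le_less_mono mult_left_mono mult_strict_left_mono) auto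
    moreover have "0 \<le> t i" using \<delta> by (simp add: t_def)
    ultimately show "t j - t i < 1" by simp
  qed
  show thesis
  proof
    show "cmod (w i) = 1" for i by (simp add: w_def power_abs)
    show "sgn (orient 0 (w i) (w j)) = \<sigma> i * \<sigma> j" if "i < j" "j < m" for i j
    proof -
      have "orient 0 (w i) (w j) = (-1) ^ (flips \<sigma> i + flips \<sigma> j) * sin (pi * (t j - t i))"
        by (subst orient_rcis) (auto simp: w_def power_add algebra_simps)
      moreover have "0 < sin (pi * (t j - t i))"
        using t[OF that] by (intro sin_gt_zero) auto
      ultimately show ?thesis using sign_mult_eq_flips[OF \<sigma>, of i j]
        by (simp add: sgn_mult power_sgn)
    qed
    show "dist (w i) (cis (2 * pi * real (half_turn_vertex k (flips \<sigma> i)) / real k)) \<le> pi * \<delta>"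
      if "i < m" for i
    proof -
      have "w i = (-1) ^ flips \<sigma> i * cis (pi * t i)" by (simp add: w_def rcis_def)
      then have "w i - cis (2 * pi * real (half_turn_vertex k (flips \<sigma> i)) / real k)
          = (-1) ^ flips \<sigma> i * (cis (pi * t i) - cis (pi * (real (flips \<sigma> i) / real k)))"
        by (simp add: cis_half_turn_vertex[OF \<open>odd k\<close>] right_diff_distrib)
      then have "dist (w i) (cis (2 * pi * real (half_turn_vertex k (flips \<sigma> i)) / real k))
          = dist (cis (pi * t i)) (cis (pi * (real (flips \<sigma> i) / real k)))"
        by (simp add: dist_norm norm_mult norm_power)
      also have "\<dots> \<le> \<bar>pi * (\<delta> * (real i / real m - real (flips \<sigma> i) / real k))\<bar>"
      proof -
        have "pi * t i - pi * (real (flips \<sigma> i) / real k)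
            = pi * (\<delta> * (real i / real m - real (flips \<sigma> i) / real k))"
          by (simp add: t_def algebra_simps add_divide_distrib diff_divide_distrib)
        then show ?thesis by (metis dist_cis_le)
      qed
      also have "\<dots> = pi * \<delta> * \<bar>real i / real m - real (flips \<sigma> i) / real k\<bar>"
        using \<delta> by (simp add: abs_mult)
      also have "\<dots> \<le> pi * \<delta> * 1"
      proof (rule mult_left_mono)
        have "0 \<le> real i / real m" "real i / real m \<le> 1" "0 \<le> real (flips \<sigma> i) / real k"
          using that by auto
        then show "\<bar>real i / real m - real (flips \<sigma> i) / real k\<bar> \<le> 1"
          using le1[OF that] by linarith
      qed (use \<delta> in simp)
      finally show ?thesis by simp
    qed
  qed
qed

lemma extreme_point_unit_circle:
  assumes "z \<in> W" "cmod z = 1" and W: "\<And>y. y \<in> W \<Longrightarrow> cmod y \<le> 1"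
  shows "z extreme_point_of (convex hull W)"
  unfolding extreme_point_of_def
proof (intro conjI ballI notI)
  show "z \<in> convex hull W" using assms(1) by (rule hull_inc)
  fix a b assume "a \<in> convex hull W" "b \<in> convex hull W" and z: "z \<in> open_segment a b"
  moreover have "convex hull W \<subseteq> cball 0 1" by (rule hull_minimal) (use W in auto)
  ultimately have "cmod a \<le> 1" "cmod b \<le> 1" by (auto simp: subset_iff)
  moreover have "cmod z < cmod a \<or> cmod z < cmod b"
    using dist_decreases_open_segment[OF z, of 0] by simp
  ultimately show False using assms(2) by linarith
qed

lemma not_interior_unit_circle:
  assumes "cmod z = 1" and W: "\<And>y. y \<in> W \<Longrightarrow> cmod y \<le> 1"
  shows "z \<notin> interior (convex hull W)"
proof -
  have "convex hull W \<subseteq> cball 0 1" by (rule hull_minimal) (use W in auto)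
  then have "interior (convex hull W) \<subseteq> ball 0 1" using interior_mono interior_cball by metis
  then show ?thesis using assms(1) by auto
qed

theorem theorem34:
  fixes P :: "complex set" and n :: nat
  assumes "finite P" and "card P = n"
    and "general_position P"
    and "\<exists>!p. p \<in> P \<and> p \<in> interior (convex hull P)"
  shows "\<exists>N. 1 + sum_list N = n \<and>
           (\<forall>\<^sub>F \<epsilon> in at_right (0::real).
              \<exists>W. generalized_wheel \<epsilon> N W \<and>
                (\<exists>\<phi>. bij_betw \<phi> P W \<and>
                  (\<forall>a\<in>P. \<forall>b\<in>P. \<forall>c\<in>P. \<forall>d\<in>P.
                     cross a b c d \<longleftrightarrow> cross (\<phi> a) (\<phi> b) (\<phi> c) (\<phi> d))))"
proof -
  obtain p where p: "p \<in> P" "p \<in> interior (convex hull P)"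
    and hull: "\<And>q. q \<in> P \<Longrightarrow> q \<noteq> p \<Longrightarrow> q \<notin> interior (convex hull P)"
    using assms(4) by metis
  define Q where "Q = P - {p}"
  define m where "m = card Q"
  have P: "P = insert p Q" and "p \<notin> Q" "finite Q" using p(1) assms(1) by (auto simp: Q_def)
  have n: "n = 1 + m" using assms(2) \<open>p \<notin> Q\<close> \<open>finite Q\<close> by (simp add: P m_def)
  have star: "star_position p Q"
    using assms(3) \<open>p \<notin> Q\<close> hull unfolding P by (intro star_position_of_not_interior) auto
  have "Q \<noteq> {}" using p(2) by (auto simp: P)
  then have m: "0 < m" using \<open>finite Q\<close> by (simp add: m_def card_gt_0_iff)
  obtain e \<sigma> where e: "bij_betw e {..<m} Q" and \<sigma>: "range \<sigma> \<subseteq> {1, -1}"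
    and sgn_e: "\<And>i j. i < j \<Longrightarrow> j < m \<Longrightarrow> sgn (orient p (e i) (e j)) = \<sigma> i * \<sigma> j"
    using enumerate_by_direction[OF \<open>finite Q\<close> \<open>p \<notin> Q\<close>] star unfolding star_position_def m_def by metis
  have Q: "Q = e ` {..<m}" using e by (simp add: bij_betw_def)
  have flips2: "2 \<le> flips \<sigma> (m - 1)"
  proof (rule ccontr)
    assume "\<not> 2 \<le> flips \<sigma> (m - 1)"
    then obtain t where t: "t < m" "\<And>j. t < j \<Longrightarrow> j < m \<Longrightarrow> \<sigma> t * \<sigma> j = 1"
      "\<And>j. j < t \<Longrightarrow> \<sigma> j * \<sigma> t = -1"
      using few_flips_source[OF \<sigma> m] by (metis One_nat_def Suc_1 not_less_eq_eq)
    have "0 \<le> orient p (e t) (e j)" if "j < m" for j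
    proof (cases j t rule: linorder_cases)
      case less
      then have "sgn (orient p (e j) (e t)) = -1" using sgn_e t by simp
      then show ?thesis by (simp add: orient_swap[of p "e t"] sgn_1_neg)
    next
      case greater
      then have "sgn (orient p (e t) (e j)) = 1" using sgn_e t that by simp
      then show ?thesis by (simp add: sgn_1_pos)
    qed simp
    then have "0 \<le> orient p (e t) z" if "z \<in> P" for z
      using that by (auto simp: P Q)
    moreover have "e t \<noteq> p" using t(1) \<open>p \<notin> Q\<close> by (auto simp: Q)
    ultimately show False using not_interior_hull_if_all_left p(2) by blast
  qed
  define k where "k = (if odd (flips \<sigma> (m - 1)) then flips \<sigma> (m - 1) else Suc (flips \<sigma> (m - 1)))"
  have k: "odd k" "flips \<sigma> (m - 1) \<le> k" "k \<le> Suc (flips \<sigma> (m - 1))"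
    by (auto simp: k_def)
  have "k \<noteq> 2" using k(1) by auto
  then have k3: "3 \<le> k" using k(2) flips2 by linarith
  define g where "g i = half_turn_vertex k (flips \<sigma> i)" for i
  define I where "I j = {i. i < m \<and> g i = j}" for j
  have g_less: "g i < k" for i unfolding g_def using k3 by (intro half_turn_vertex_less) simp
  have I_union: "{..<m} = (\<Union>j<k. I j)" using g_less by (auto simp: I_def)
  have I_nonempty: "I j \<noteq> {}" if "j < k" for j
  proof -
    obtain l where l: "l < k" "half_turn_vertex k l = j" using half_turn_vertex_onto k(1) \<open>j < k\<close> by blast
    then obtain i where "i \<le> m - 1" "flips \<sigma> i = l" using flips_onto[of l \<sigma> "m - 1"] k(3) by auto
    then have "i \<in> I j" using m l by (auto simp: I_def g_def)
    then show ?thesis by blast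
  qed
  define N where "N = map (\<lambda>j. card (I j)) [0..<k]"
  have "sum_list N = (\<Sum>j<k. card (I j))"
    by (simp add: N_def interv_sum_list_conv_sum_set_nat atLeast0LessThan)
  also have "\<dots> = card (\<Union>j<k. I j)" by (rule card_UN_disjoint[symmetric]) (auto simp: I_def)
  also have "\<dots> = m" by (simp flip: I_union)
  finally have "1 + sum_list N = n" by (simp add: n)
  moreover have "\<exists>W. generalized_wheel \<epsilon> N W \<and> (\<exists>\<phi>. bij_betw \<phi> P W \<and>
      (\<forall>a\<in>P. \<forall>b\<in>P. \<forall>c\<in>P. \<forall>d\<in>P. cross a b c d \<longleftrightarrow> cross (\<phi> a) (\<phi> b) (\<phi> c) (\<phi> d)))"
    if \<epsilon>: "0 < \<epsilon>" "\<epsilon> < 1" for \<epsilon> :: real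
  proof -
    obtain w where w_norm: "\<And>i. cmod (w i) = 1"
      and w_less: "\<And>i j. i < j \<Longrightarrow> j < m \<Longrightarrow> sgn (orient 0 (w i) (w j)) = \<sigma> i * \<sigma> j"
      and w_dist: "\<And>i. i < m \<Longrightarrow> dist (w i) (cis (2 * pi * real (g i) / real k)) \<le> pi * (\<epsilon> / 4)"
      unfolding g_def using exists_wheel_points[OF \<sigma> k(1,2), of "\<epsilon> / 4"] \<epsilon> by auto
    have w_sgn: "sgn (orient 0 (w i) (w j)) = sgn (orient p (e i) (e j))" if "i < m" "j < m" for i j
    proof (cases i j rule: linorder_cases)
      case less
      then show ?thesis using that w_less sgn_e by simp
    next
      case greater
      then have "sgn (orient 0 (w j) (w i)) = sgn (orient p (e j) (e i))"
        using that w_less sgn_e by simp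
      then show ?thesis
        by (simp add: orient_swap[of 0 "w i" "w j"] orient_swap[of p "e i" "e j"] sgn_minus)
    qed simp
    define W where "W = insert 0 (w ` {..<m})"
    define \<phi> where "\<phi> x = (if x = p then 0 else w (inv_into {..<m} e x))" for x
    have \<phi>_p: "\<phi> p = 0" by (simp add: \<phi>_def)
    have \<phi>_e: "\<phi> (e i) = w i" if "i < m" for i
      using that \<open>p \<notin> Q\<close> bij_betw_imp_inj_on[OF e] by (auto simp: \<phi>_def Q)
    have \<phi>_Q: "\<phi> ` Q = w ` {..<m}" using \<phi>_e by (force simp: Q)
    have w_inj: "i = j" if "i < m" "j < m" "w i = w j" for i j
    proof (rule ccontr)
      assume "i \<noteq> j"
      then have "e i \<noteq> e j" using bij_betw_imp_inj_on[OF e] that by (auto dest: inj_onD)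
      then have "orient p (e i) (e j) \<noteq> 0" using star that by (auto simp: star_position_def Q)
      then show False using w_sgn[OF that(1,2)] that(3) by (simp add: sgn_zero_iff)
    qed
    have starW: "star_position 0 (w ` {..<m})"
    proof (rule star_position_unit_circle)
      show "orient 0 a b \<noteq> 0" if ab: "a \<in> w ` {..<m}" "b \<in> w ` {..<m}" "a \<noteq> b" for a b
      proof -
        obtain i j where ij: "i < m" "j < m" "a = w i" "b = w j" using ab by auto
        then have "e i \<noteq> e j" using bij_betw_imp_inj_on[OF e] ab(3) by (auto dest: inj_onD)
        then have "orient p (e i) (e j) \<noteq> 0" using star ij by (auto simp: star_position_def Q)
        then show ?thesis using w_sgn ij by (metis sgn_zero_iff)
      qed
    qed (auto simp: w_norm)
    have \<phi>_sgn: "sgn (orient (\<phi> a) (\<phi> b) (\<phi> c)) = sgn (orient a b c)"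
      if "a \<in> P" "b \<in> P" "c \<in> P" for a b c
    proof (rule star_position_insert_orient_cong[OF star])
      show "star_position (\<phi> p) (\<phi> ` Q)" by (simp add: \<phi>_p \<phi>_Q starW)
      show "sgn (orient (\<phi> p) (\<phi> x) (\<phi> y)) = sgn (orient p x y)" if "x \<in> Q" "y \<in> Q" for x y
        using that w_sgn by (auto simp: \<phi>_p \<phi>_e Q)
    qed (use that in \<open>auto simp: P\<close>)
    have bij: "bij_betw \<phi> P W"
    proof (rule bij_betw_imageI)
      have "\<phi> q \<noteq> 0" if "q \<in> Q" for q using that w_norm by (auto simp: Q \<phi>_e) (metis norm_zero zero_neq_one)
      moreover have "inj_on \<phi> Q"
      proof (rule inj_onI)
        fix x y assume "x \<in> Q" "y \<in> Q" and eq: "\<phi> x = \<phi> y"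
        then obtain i j where ij: "i < m" "j < m" "x = e i" "y = e j" by (auto simp: Q)
        then have "i = j" using eq \<phi>_e w_inj by metis
        then show "x = y" using ij by simp
      qed
      ultimately show "inj_on \<phi> P" using \<phi>_p by (auto simp: P inj_on_def)
      show "\<phi> ` P = W" by (simp add: P W_def \<phi>_p \<phi>_Q)
    qed
    have gpW: "general_position W" using general_position_cong_orient[OF assms(3) bij \<phi>_sgn] .
    have W_norm: "cmod y \<le> 1" if "y \<in> W" for y using that by (auto simp: W_def w_norm)
    have W_interior: "W \<inter> interior (convex hull W) = {0}"
    proof -
      obtain c where c: "c \<le> m - 1" "flips \<sigma> c = 2" using flips_onto flips2 by blast
      obtain b where b: "b \<le> c" "flips \<sigma> b = 1" using flips_onto[of 1 \<sigma> c] c by auto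
      obtain a where a: "a \<le> b" "flips \<sigma> a = 0" using flips_onto[of 0 \<sigma> b] by auto
      have abc: "a < b" "b < c" "c < m" using a b c m by (auto simp: le_less)
      have "sgn (orient 0 (w a) (w c)) = 1"
        using w_less[of a c] abc sign_mult_eq_flips[OF \<sigma>, of a c] a c by simp
      moreover have "sgn (orient 0 (w b) (w c)) = -1"
        using w_less[of b c] abc sign_mult_eq_flips[OF \<sigma>, of b c] b c by simp
      moreover have "sgn (orient 0 (w a) (w b)) = -1"
        using w_less[of a b] abc sign_mult_eq_flips[OF \<sigma>, of a b] a b by simp
      ultimately have "0 \<in> interior (convex hull {w a, w c, w b})"
        using orient_swap[of 0 "w b" "w c"] orient_swap[of 0 "w a" "w b"]
        by (intro interior_triangle) (auto simp: sgn_1_pos sgn_1_neg)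
      moreover have "interior (convex hull {w a, w c, w b}) \<subseteq> interior (convex hull W)"
        using abc by (intro interior_mono hull_mono) (auto simp: W_def)
      moreover have "w i \<notin> interior (convex hull W)" for i
        using not_interior_unit_circle w_norm W_norm by blast
      ultimately show ?thesis by (auto simp: W_def)
    qed
    have "generalized_wheel \<epsilon> N W"
    proof -
      have "length N = k" by (simp add: N_def)
      have N_nth: "N ! i = card (I i)" if "i < k" for i using that by (simp add: N_def)
      have "1 \<le> card (I i)" if "i < k" for i
        using I_nonempty[OF that] by (simp add: Suc_le_eq card_gt_0_iff I_def)
      moreover have "W = insert 0 (\<Union>i<k. w ` I i)"
        by (simp add: W_def I_union image_UN)
      moreover have "disjoint_family_on (\<lambda>i. w ` I i) {..<k}"
        unfolding disjoint_family_on_def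
      proof (intro ballI impI equals0I)
        fix i j z assume "i \<noteq> j" "z \<in> w ` I i \<inter> w ` I j"
        then show False unfolding I_def using w_inj by blast
      qed
      moreover have "finite (w ` I i) \<and> card (w ` I i) = card (I i)" for i
        using w_inj by (auto simp: I_def intro!: card_image inj_onI)
      moreover have "dist x (0 + 1 * cis (2 * pi * real i / real k)) < \<epsilon> * norm (1::complex)"
        if "x \<in> w ` I i" for x i
      proof -
        have "dist x (cis (2 * pi * real i / real k)) \<le> pi * (\<epsilon> / 4)"
          using that w_dist by (auto simp: I_def)
        also have "\<dots> < 4 * (\<epsilon> / 4)" using \<epsilon> pi_less_4 by (intro mult_strict_right_mono) auto
        finally show ?thesis by simp
      qed
      moreover have "x extreme_point_of (convex hull W)" if "x \<in> w ` I i" for x i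
        using that w_norm W_norm by (intro extreme_point_unit_circle) (auto simp: W_def I_def)
      ultimately show ?thesis
        unfolding generalized_wheel_def Let_def \<open>length N = k\<close>
        using k(1) k3 gpW W_interior N_nth
        by (intro conjI exI[of _ 0] exI[of _ 1] exI[of _ "\<lambda>i. w ` I i"]) auto
    qed
    moreover have "cross a b c d \<longleftrightarrow> cross (\<phi> a) (\<phi> b) (\<phi> c) (\<phi> d)"
      if "a \<in> P" "b \<in> P" "c \<in> P" "d \<in> P" for a b c d
      using cross_cong_orient[OF assms(3) gpW bij \<phi>_sgn] that by blast
    ultimately show ?thesis using bij by blast
  qed
  then have "\<forall>\<^sub>F \<epsilon> in at_right (0::real). \<exists>W. generalized_wheel \<epsilon> N W \<and> (\<exists>\<phi>. bij_betw \<phi> P W \<and>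
      (\<forall>a\<in>P. \<forall>b\<in>P. \<forall>c\<in>P. \<forall>d\<in>P. cross a b c d \<longleftrightarrow> cross (\<phi> a) (\<phi> b) (\<phi> c) (\<phi> d)))"
    using eventually_at_right_real[of 0 1] by (auto elim!: eventually_mono)
  ultimately show ?thesis by blast
qed

end
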